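(* Let $T=(V,E,m_1,m_2)$ be a finite tree with at least one edge, with vertex measure $m_1:V\to(0,\infty)$ and symmetric edge measure $m_2:E\to(0,\infty)$, and let $\omega(t,e)$ be the solution of the weighted Lin-Lu-Yau curvature flow $$\frac{d}{dt}\omega(t,e)=-\kappa_\omega(t,e)\,\omega(t,e),\quad t>0,\ e\in E,\qquad \omega(0,e)=\omega_0(e),$$ with positive initial value $\omega_0:E\to(0,\infty)$. Then there is a constant $c\in\mathbb R$, independent of $e$, such that $\kappa_\omega(t,e)\to c$ as $t\to\infty$ for every $e\in E$. Moreover, the normalized metric $$\bar\omega(t,e)=\frac{\omega(t,e)}{\sum_{h\in E}\omega(t,h)}$$ converges as $t\to\infty$ to a constant curvature metric, i.e. to a weight $\bar\omega_\infty:E\to(0,\infty)$ for which $\kappa_{\bar\omega_\infty}(e)$ has the same value for all $e\in E$.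
   Context: Write $x\sim y$ if $(x,y)\in E$. For a weight (metric) $\omega:E\to(0,\infty)$, $d_\omega(u,v)=\inf\{\sum_{k=1}^n\omega(v_{k-1},v_k): u=v_0\sim v_1\sim\cdots\sim v_n=v\}$. Let $\operatorname{Deg}(x)=\frac{1}{m_1(x)}\sum_{y\sim x}m_2(x,y)$. For small $\epsilon>0$ let $m_x^\epsilon$ be the probability measure on $V$ with $m_x^\epsilon(x)=1-\epsilon\operatorname{Deg}(x)$, $m_x^\epsilon(y)=\epsilon\, m_2(x,y)/m_1(x)$ for $y\sim x$, and $m_x^\epsilon(y)=0$ otherwise (fixed in time, independent of $\omega$). The weighted Lin-Lu-Yau curvature of $e=(x,y)\in E$ is $$\kappa_\omega(e)=\kappa_\omega(x,y)=\lim_{\epsilon\to0^+}\frac1\epsilon\Big(1-\frac{W(m_x^\epsilon,m_y^\epsilon)}{d_\omega(x,y)}\Big),$$ where $W(m_x^\epsilon,m_y^\epsilon)=\inf_A\sum_{u,v\in V}d_\omega(u,v)A(u,v)$ is the Wasserstein distance with respect to $d_\omega$, the infimum being over all couplings $A$ of $m_x^\epsilon$ and $m_y^\epsilon$. $\kappa_\omega(t,e)$ denotes the curvature computed with the weight $\omega(t,\cdot)$. *)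

theory Defs
  imports Complex_Main
begin

text \<open>
  A simple graph is a vertex set \<open>V\<close> together with a set \<open>E\<close> of unordered pairs \<open>{x, y}\<close> of
  distinct vertices. Functions on edges (the edge measure \<open>m2\<close>, the weights \<open>\<omega>\<close>) have type
  \<open>'a set \<Rightarrow> real\<close>, which makes them symmetric by construction, and sums over \<open>E\<close> count every edge
  once. Values outside \<open>V\<close> respectively \<open>E\<close> are never used.
\<close>

definition adjacent :: "'a set set \<Rightarrow> 'a \<Rightarrow> 'a \<Rightarrow> bool" where
  "adjacent E x y \<longleftrightarrow> {x, y} \<in> E"

definition simple_graph :: "'a set \<Rightarrow> 'a set set \<Rightarrow> bool" where
  "simple_graph V E \<longleftrightarrow> (\<forall>e\<in>E. \<exists>x\<in>V. \<exists>y\<in>V. x \<noteq> y \<and> e = {x, y})"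

definition walk :: "'a set set \<Rightarrow> 'a \<Rightarrow> 'a list \<Rightarrow> 'a \<Rightarrow> bool" where
  "walk E u xs v \<longleftrightarrow> xs \<noteq> [] \<and> hd xs = u \<and> last xs = v \<and> successively (adjacent E) xs"

definition connected_graph :: "'a set \<Rightarrow> 'a set set \<Rightarrow> bool" where
  "connected_graph V E \<longleftrightarrow> V \<noteq> {} \<and> (\<forall>u\<in>V. \<forall>v\<in>V. \<exists>xs. walk E u xs v)"

definition graph_cycle :: "'a set set \<Rightarrow> 'a list \<Rightarrow> bool" where
  "graph_cycle E xs \<longleftrightarrow>
     length xs \<ge> 3 \<and> distinct xs \<and> successively (adjacent E) xs \<and> adjacent E (last xs) (hd xs)"

definition finite_tree :: "'a set \<Rightarrow> 'a set set \<Rightarrow> bool" where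
  "finite_tree V E \<longleftrightarrow>
     finite V \<and> simple_graph V E \<and> connected_graph V E \<and> \<not> (\<exists>xs. graph_cycle E xs)"

definition walk_length :: "('a set \<Rightarrow> real) \<Rightarrow> 'a list \<Rightarrow> real" where
  "walk_length \<omega> xs = (\<Sum>k<length xs - 1. \<omega> {xs ! k, xs ! Suc k})"

definition weighted_dist :: "'a set set \<Rightarrow> ('a set \<Rightarrow> real) \<Rightarrow> 'a \<Rightarrow> 'a \<Rightarrow> real" where
  "weighted_dist E \<omega> u v = Inf {walk_length \<omega> xs | xs. walk E u xs v}"

definition weighted_degree ::
  "'a set set \<Rightarrow> ('a \<Rightarrow> real) \<Rightarrow> ('a set \<Rightarrow> real) \<Rightarrow> 'a \<Rightarrow> real" where
  "weighted_degree E m1 m2 x = 1 / m1 x * (\<Sum>y | adjacent E x y. m2 {x, y})"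

definition step_measure ::
  "'a set set \<Rightarrow> ('a \<Rightarrow> real) \<Rightarrow> ('a set \<Rightarrow> real) \<Rightarrow> real \<Rightarrow> 'a \<Rightarrow> 'a \<Rightarrow> real" where
  "step_measure E m1 m2 \<epsilon> x y =
     (if y = x then 1 - \<epsilon> * weighted_degree E m1 m2 x
      else if adjacent E x y then \<epsilon> * m2 {x, y} / m1 x
      else 0)"

definition coupling :: "'a set \<Rightarrow> ('a \<Rightarrow> real) \<Rightarrow> ('a \<Rightarrow> real) \<Rightarrow> ('a \<Rightarrow> 'a \<Rightarrow> real) \<Rightarrow> bool" where
  "coupling V \<mu> \<nu> A \<longleftrightarrow>
     (\<forall>u\<in>V. \<forall>v\<in>V. A u v \<ge> 0) \<and>
     (\<forall>u\<in>V. (\<Sum>v\<in>V. A u v) = \<mu> u) \<and>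
     (\<forall>v\<in>V. (\<Sum>u\<in>V. A u v) = \<nu> v)"

definition wasserstein ::
  "'a set \<Rightarrow> ('a \<Rightarrow> 'a \<Rightarrow> real) \<Rightarrow> ('a \<Rightarrow> real) \<Rightarrow> ('a \<Rightarrow> real) \<Rightarrow> real" where
  "wasserstein V d \<mu> \<nu> = Inf {\<Sum>u\<in>V. \<Sum>v\<in>V. d u v * A u v | A. coupling V \<mu> \<nu> A}"

definition lly_curvature ::
  "'a set \<Rightarrow> 'a set set \<Rightarrow> ('a \<Rightarrow> real) \<Rightarrow> ('a set \<Rightarrow> real) \<Rightarrow> ('a set \<Rightarrow> real) \<Rightarrow> 'a \<Rightarrow> 'a \<Rightarrow> real" where
  "lly_curvature V E m1 m2 \<omega> x y =
     Lim (at_right 0) (\<lambda>\<epsilon>. 1 / \<epsilon> *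
       (1 - wasserstein V (weighted_dist E \<omega>) (step_measure E m1 m2 \<epsilon> x) (step_measure E m1 m2 \<epsilon> y)
            / weighted_dist E \<omega> x y))"

text \<open>
  A solution is a family of (positive) weights on \<open>[0, \<infinity>)\<close>. The equation is only required for
  \<open>t > 0\<close>, so continuity at \<open>0\<close> is what ties the solution to its initial value.
\<close>

definition lly_flow_solution ::
  "'a set \<Rightarrow> 'a set set \<Rightarrow> ('a \<Rightarrow> real) \<Rightarrow> ('a set \<Rightarrow> real) \<Rightarrow> ('a set \<Rightarrow> real) \<Rightarrow>
   (real \<Rightarrow> 'a set \<Rightarrow> real) \<Rightarrow> bool" where
  "lly_flow_solution V E m1 m2 \<omega>0 \<omega> \<longleftrightarrow>
     (\<forall>t\<ge>0. \<forall>e\<in>E. \<omega> t e > 0) \<and>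
     (\<forall>e\<in>E. \<omega> 0 e = \<omega>0 e) \<and>
     (\<forall>e\<in>E. continuous_on {0..} (\<lambda>t. \<omega> t e)) \<and>
     (\<forall>t>0. \<forall>x y. {x, y} \<in> E \<longrightarrow>
        ((\<lambda>s. \<omega> s {x, y}) has_real_derivative
           - lly_curvature V E m1 m2 (\<omega> t) x y * \<omega> t {x, y}) (at t))"

definition normalized_weight :: "'a set set \<Rightarrow> ('a set \<Rightarrow> real) \<Rightarrow> 'a set \<Rightarrow> real" where
  "normalized_weight E \<omega> e = \<omega> e / (\<Sum>h\<in>E. \<omega> h)"

definition constant_curvature ::
  "'a set \<Rightarrow> 'a set set \<Rightarrow> ('a \<Rightarrow> real) \<Rightarrow> ('a set \<Rightarrow> real) \<Rightarrow> ('a set \<Rightarrow> real) \<Rightarrow> bool" where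
  "constant_curvature V E m1 m2 \<omega> \<longleftrightarrow>
     (\<exists>k. \<forall>x y. {x, y} \<in> E \<longrightarrow> lly_curvature V E m1 m2 \<omega> x y = k)"

end

theory Submission
  imports Defs "HOL-Analysis.Analysis"
begin

text \<open>
  On a tree the curvature is explicit: testing the Wasserstein distance against the potential that
  is the distance to \<open>x\<close> (shifted by \<open>\<omega> {x, y}\<close>) on the side of \<open>x\<close> and minus the distance to \<open>y\<close> on
  the other side, and against the coupling that moves every unit of mass through \<open>x\<close> or \<open>y\<close>, gives
  \<open>\<kappa>(e) \<omega>(e) = - (\<Sum>f. B e f \<omega>(f))\<close> with a matrix \<open>B\<close> that does not depend on \<open>\<omega>\<close>. Hence the flow
  is the linear equation \<open>\<omega>' = B \<omega>\<close>. The matrix \<open>B\<close> is nonnegative off the diagonal, irreducible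
  because the tree is connected, and symmetric with respect to \<open>m2\<close>, so it has a positive eigenvector
  \<open>v\<close> for some eigenvalue \<open>l\<close>. The quotient \<open>exp (- l t) \<omega>(t) / v\<close> solves a heat equation on a
  connected finite graph and therefore converges to a positive constant, which makes \<open>v\<close> the limit
  shape and \<open>- l\<close> the limit curvature.
\<close>

section \<open>Linear flows with symmetrizable irreducible Metzler matrices\<close>

lemma compact_nonneg_sphere:
  fixes p :: "'i \<Rightarrow> real"
  assumes "finite I" and p: "\<And>e. e \<in> I \<Longrightarrow> p e > 0"
  shows "compact {w. (\<forall>e\<in>I. w e \<ge> 0) \<and> (\<forall>e. e \<notin> I \<longrightarrow> w e = 0) \<and> (\<Sum>e\<in>I. p e * (w e)\<^sup>2) = 1}"
    (is "compact ?K")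
proof -
  \<comment> \<open>The constraint bounds each coordinate in \<open>I\<close> by
    \<open>1 / sqrt (p e)\<close>, and prescribing the value 0 outside \<open>I\<close> makes the
    remaining factors singletons. The set is thus a closed subset of a product of compact sets, and
    Tychonoff applies.\<close>
  define R where "R e = (if e \<in> I then {0..1 / sqrt (p e)} else {0})" for e
  have "compact (Pi\<^sub>E UNIV R)"
    using compactin_PiE[of "\<lambda>_. euclidean" UNIV R]
    by (simp add: R_def euclidean_product_topology)
  moreover have "closed {w. (\<Sum>e\<in>I. p e * (w e)\<^sup>2) = 1}"
    by (intro closed_Collect_eq continuous_intros continuous_on_product_coordinates)
  ultimately have "compact (Pi\<^sub>E UNIV R \<inter> {w. (\<Sum>e\<in>I. p e * (w e)\<^sup>2) = 1})"
    by (rule compact_Int_closed)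
  moreover have "Pi\<^sub>E UNIV R \<inter> {w. (\<Sum>e\<in>I. p e * (w e)\<^sup>2) = 1} = ?K"
  proof (intro equalityI subsetI)
    fix w assume w: "w \<in> ?K"
    have "w e \<le> 1 / sqrt (p e)" if e: "e \<in> I" for e
    proof -
      have "p e * (w e)\<^sup>2 \<le> (\<Sum>e\<in>I. p e * (w e)\<^sup>2)"
        using assms(1) e p by (intro member_le_sum) (simp_all add: less_imp_le)
      then have "(w e)\<^sup>2 \<le> 1 / p e"
        using w p[OF e] by (simp add: field_simps)
      then have "w e \<le> sqrt (1 / p e)"
        by (rule real_le_rsqrt)
      then show ?thesis by (simp add: real_sqrt_divide)
    qed
    then show "w \<in> Pi\<^sub>E UNIV R \<inter> {w. (\<Sum>e\<in>I. p e * (w e)\<^sup>2) = 1}"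
      using w by (auto simp: R_def)
  next
    fix w assume w: "w \<in> Pi\<^sub>E UNIV R \<inter> {w. (\<Sum>e\<in>I. p e * (w e)\<^sup>2) = 1}"
    then have "w e \<in> R e" for e by auto
    then have "e \<in> I \<Longrightarrow> w e \<ge> 0" "e \<notin> I \<Longrightarrow> w e = 0" for e
      by (auto simp: R_def dest: meta_spec[of _ e])
    then show "w \<in> ?K" using w by blast
  qed
  ultimately show ?thesis by simp
qed

text \<open>Dividing by \<open>s\<close> and letting \<open>s\<close> tend to 0 from the right gives
  the claim. This extracts the first-order condition at a maximizer when only one-sided variations
  are allowed.\<close>

lemma nonpos_if_le_quadratic:
  fixes a b :: real
  assumes "\<And>s. 0 < s \<Longrightarrow> s * a \<le> s\<^sup>2 * b"
  shows "a \<le> 0"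
proof (rule tendsto_lowerbound)
  show "((\<lambda>s. s * b) \<longlongrightarrow> 0) (at_right 0)"
    by (auto intro!: tendsto_eq_intros)
  show "\<forall>\<^sub>F s in at_right 0. a \<le> s * b"
    using assms by (auto simp: eventually_at_right_field power2_eq_square intro!: exI[of _ 1])
qed auto

text \<open>A variational form of the Perron-Frobenius theorem. By symmetry of \<open>S\<close>, a
  maximizer of the quadratic form \<open>q\<close> on the nonnegative part of the sphere
  \<open>N w = 1\<close> is a candidate eigenvector, with the maximum as eigenvalue. The sign
  condition off the diagonal and connectedness keep it away from the boundary.\<close>

lemma ex_perron_vector:
  fixes p :: "'i \<Rightarrow> real" and S :: "'i \<Rightarrow> 'i \<Rightarrow> real"
  assumes fin: "finite I" and ne: "I \<noteq> {}"
    and p: "\<And>e. e \<in> I \<Longrightarrow> p e > 0"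
    and sym: "\<And>e f. S e f = S f e"
    and nonneg: "\<And>e f. e \<in> I \<Longrightarrow> f \<in> I \<Longrightarrow> e \<noteq> f \<Longrightarrow> S e f \<ge> 0"
    and conn: "\<And>e f. e \<in> I \<Longrightarrow> f \<in> I \<Longrightarrow> (\<lambda>e f. e \<in> I \<and> f \<in> I \<and> e \<noteq> f \<and> S e f > 0)\<^sup>*\<^sup>* e f"
  shows "\<exists>l v. (\<forall>e\<in>I. v e > 0) \<and> (\<forall>e\<in>I. (\<Sum>f\<in>I. S e f * v f) = l * p e * v e)"
proof -
  define K where "K = {w. (\<forall>e\<in>I. w e \<ge> 0) \<and> (\<forall>e. e \<notin> I \<longrightarrow> w e = 0) \<and> (\<Sum>e\<in>I. p e * (w e)\<^sup>2) = (1::real)}"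
  define q where "q w = (\<Sum>e\<in>I. \<Sum>f\<in>I. S e f * w e * w f)" for w :: "'i \<Rightarrow> real"
  define N where "N w = (\<Sum>e\<in>I. p e * (w e)\<^sup>2)" for w :: "'i \<Rightarrow> real"
  obtain i where i: "i \<in> I" using ne by auto
  have "(\<lambda>e. if e = i then 1 / sqrt (p i) else 0) \<in> K"
    using i p[OF i] fin by (auto simp: K_def power_divide if_distrib[of "\<lambda>x. x\<^sup>2"] if_distrib[of "\<lambda>x. _ * x"] cong: if_cong)
  moreover have "continuous_on K q"
    unfolding q_def by (intro continuous_intros continuous_on_subset[OF continuous_on_product_coordinates]) auto
  moreover have "compact K" unfolding K_def by (rule compact_nonneg_sphere[OF fin p])
  ultimately obtain v where v: "v \<in> K" and max: "\<And>w. w \<in> K \<Longrightarrow> q w \<le> q v"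
    using continuous_attains_sup[of K q] by blast
  define l where "l = q v"
  have vnn: "v e \<ge> 0" if "e \<in> I" for e using v that by (auto simp: K_def)
  have Nv: "N v = 1" using v by (auto simp: K_def N_def)
  \<comment> \<open>Both \<open>q\<close> and \<open>N\<close> are homogeneous of degree two, so the
    maximum over \<open>K\<close> bounds \<open>q\<close> on all nonnegative vectors. The rescaled
    \<open>z\<close> is cut off outside \<open>I\<close> because \<open>K\<close> demands
    it.\<close>
  have rayleigh: "q w \<le> l * N w" if w: "\<And>e. e \<in> I \<Longrightarrow> w e \<ge> 0" for w
  proof (cases "N w = 0")
    case True
    then have "w e = 0" if "e \<in> I" for e
      using that p fin by (force simp: N_def sum_nonneg_eq_0_iff less_imp_le)
    then have "q w = 0" by (simp add: q_def)
    then show ?thesis using True by simp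
  next
    case False
    then have N: "N w > 0"
      using p by (auto simp: N_def less_imp_le order.strict_iff_order intro!: sum_nonneg)
    define z where "z e = (if e \<in> I then w e / sqrt (N w) else 0)" for e
    have "N z = N w / N w"
    proof -
      have "N z = (\<Sum>e\<in>I. p e * (w e)\<^sup>2 / N w)"
        unfolding N_def[of z] using N by (intro sum.cong refl) (auto simp: z_def power_divide)
      then show ?thesis by (simp add: sum_divide_distrib[symmetric] N_def)
    qed
    then have "z \<in> K" using N w by (auto simp: K_def z_def N_def)
    moreover have "q z = q w / N w"
      unfolding q_def[of z] q_def[of w] sum_divide_distrib
      using N by (intro sum.cong refl) (auto simp: z_def)
    ultimately show ?thesis
      using mult_left_mono[OF max[of z], of "N w"] N by (simp add: l_def mult.commute)
  qed
  \<comment> \<open>Only perturbations that increase an entry of the maximizer are admissible, so the first variation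
    gives an inequality; pairing it with \<open>v\<close> turns it into an equality at the end.\<close>
  have sub: "(\<Sum>f\<in>I. S e f * v f) \<le> l * p e * v e" if e: "e \<in> I" for e
  proof -
    define T where "T = (\<Sum>f\<in>I. S e f * v f)"
    have "s * (2 * T - 2 * l * p e * v e) \<le> s\<^sup>2 * (l * p e - S e e)" if s: "s > 0" for s
    proof -
      define w where "w f = v f + s * (if f = e then 1 else 0)" for f
      have "q w = (\<Sum>a\<in>I. \<Sum>f\<in>I. S a f * v a * v f
          + (if f = e then s * S a e * v a else 0) + (if a = e then s * S e f * v f else 0)
          + (if a = e then if f = e then s\<^sup>2 * S e e else 0 else 0))"
        unfolding q_def w_def by (intro sum.cong refl) (auto simp: algebra_simps power2_eq_square)
      also have "\<dots> = q v + (\<Sum>a\<in>I. s * S a e * v a) + (\<Sum>f\<in>I. s * S e f * v f) + s\<^sup>2 * S e e"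
      proof -
        have "(\<Sum>a\<in>I. \<Sum>f\<in>I. if a = e then s * S e f * v f else 0) = (\<Sum>f\<in>I. s * S e f * v f)"
          using fin e by (subst sum.swap) simp
        moreover have "(\<Sum>a\<in>I. \<Sum>f\<in>I. if a = e then if f = e then s\<^sup>2 * S e e else 0 else 0) = s\<^sup>2 * S e e"
          using fin e by (subst sum.swap) simp
        ultimately show ?thesis
          using fin e by (simp add: sum.distrib q_def)
      qed
      also have "(\<Sum>a\<in>I. s * S a e * v a) = s * T"
        by (simp add: T_def sum_distrib_left mult.assoc sym[of _ e])
      also have "(\<Sum>f\<in>I. s * S e f * v f) = s * T"
        by (simp add: T_def sum_distrib_left mult.assoc)
      finally have qw: "q w = q v + s * T + s * T + s\<^sup>2 * S e e" .
      have "N w = (\<Sum>f\<in>I. p f * (v f)\<^sup>2 + (if f = e then 2 * s * p e * v e + s\<^sup>2 * p e else 0))"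
        unfolding N_def w_def by (intro sum.cong refl) (auto simp: algebra_simps power2_eq_square)
      then have Nw: "N w = N v + 2 * s * p e * v e + s\<^sup>2 * p e"
        using fin e by (simp add: sum.distrib N_def)
      have "q w \<le> l * N w" using vnn s by (intro rayleigh) (auto simp: w_def)
      then show ?thesis unfolding qw Nw Nv by (simp add: l_def algebra_simps)
    qed
    then have "2 * T - 2 * l * p e * v e \<le> 0" by (rule nonpos_if_le_quadratic)
    then show ?thesis by (simp add: T_def)
  qed
  \<comment> \<open>At a zero of \<open>v\<close> the diagonal term vanishes, so the sum in
    \<open>sub\<close> is both nonnegative and at most 0. All its terms are then 0, and zeros spread
    along positive entries.\<close>
  have step: "v f = 0" if "e \<in> I" "f \<in> I" "e \<noteq> f" "S e f > 0" "v e = 0" for e f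
  proof -
    have nn: "S e g * v g \<ge> 0" if "g \<in> I" for g
      using nonneg[of e g] vnn[of g] \<open>e \<in> I\<close> \<open>v e = 0\<close> that by (cases "g = e") auto
    have "(\<Sum>f\<in>I. S e f * v f) = 0"
      using sub[OF \<open>e \<in> I\<close>] \<open>v e = 0\<close> nn by (intro antisym sum_nonneg) auto
    then have "S e f * v f = 0" 
      using sum_nonneg_eq_0_iff[OF fin, of "\<lambda>f. S e f * v f"] nn \<open>f \<in> I\<close> by auto
    then show ?thesis using \<open>S e f > 0\<close> by simp
  qed
  have pos: "v e > 0" if e: "e \<in> I" for e
  proof (rule ccontr)
    assume "\<not> v e > 0"
    then have e0: "v e = 0" using vnn[OF e] by simp
    have "v f = 0" if f: "f \<in> I" for f
      using conn[OF e f] by (induction) (use e0 step in auto)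
    then have "N v = 0" by (simp add: N_def)
    then show False using Nv by simp
  qed
  have "(\<Sum>e\<in>I. v e * (l * p e * v e - (\<Sum>f\<in>I. S e f * v f))) = l * N v - q v"
    by (simp add: N_def q_def algebra_simps sum_subtractf sum_distrib_left power2_eq_square)
  then have "(\<Sum>e\<in>I. v e * (l * p e * v e - (\<Sum>f\<in>I. S e f * v f))) = 0"
    using Nv by (simp add: l_def)
  then have "\<forall>e\<in>I. v e * (l * p e * v e - (\<Sum>f\<in>I. S e f * v f)) = 0"
    using sub vnn by (subst (asm) sum_nonneg_eq_0_iff[OF fin]) auto
  then have "(\<Sum>f\<in>I. S e f * v f) = l * p e * v e" if "e \<in> I" for e
    using pos[OF that] that by auto
  with pos show ?thesis by blast
qed

section \<open>Convergence of the heat flow on a finite connected network\<close>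

lemma ex_difference_le_dirichlet:
  fixes c :: "'i \<Rightarrow> 'i \<Rightarrow> real"
  assumes fin: "finite I"
    and nonneg: "\<And>e f. e \<in> I \<Longrightarrow> f \<in> I \<Longrightarrow> e \<noteq> f \<Longrightarrow> c e f \<ge> 0"
    and path: "(\<lambda>e f. e \<in> I \<and> f \<in> I \<and> e \<noteq> f \<and> c e f > 0)\<^sup>*\<^sup>* e g"
  shows "\<exists>C\<ge>0. \<forall>u. (u e - u g)\<^sup>2 \<le> C * (\<Sum>e\<in>I. \<Sum>f\<in>I. c e f * (u f - u e)\<^sup>2)"
  using path
proof induction
  case base
  then show ?case by (intro exI[of _ 0]) auto
next
  case (step f g)
  then obtain C where C: "C \<ge> 0" "\<And>u. (u e - u f)\<^sup>2 \<le> C * (\<Sum>e\<in>I. \<Sum>f\<in>I. c e f * (u f - u e)\<^sup>2)"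
    by blast
  \<comment> \<open>Extending the path by one link uses \<open>(a + b)^2 <= 2 a^2 + 2 b^2\<close>:
    the first part is bounded by induction, and the last link is controlled by its own term of the
    Dirichlet sum, at the cost of \<open>1 / c f g\<close>.\<close>
  have "(u e - u g)\<^sup>2 \<le> (2 * C + 2 / c f g) * (\<Sum>e\<in>I. \<Sum>f\<in>I. c e f * (u f - u e)\<^sup>2)" for u
  proof -
    have nn: "c a b * (u b - u a)\<^sup>2 \<ge> 0" if "a \<in> I" "b \<in> I" for a b
      using nonneg[of a b] that by (cases "a = b") auto
    have "c f g * (u g - u f)\<^sup>2 \<le> (\<Sum>b\<in>I. c f b * (u b - u f)\<^sup>2)"
      using step fin nn by (intro member_le_sum[of g I "\<lambda>b. c f b * (u b - u f)\<^sup>2"]) auto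
    also have "\<dots> \<le> (\<Sum>a\<in>I. \<Sum>b\<in>I. c a b * (u b - u a)\<^sup>2)"
      using step fin nn by (intro member_le_sum[of f I "\<lambda>a. \<Sum>b\<in>I. c a b * (u b - u a)\<^sup>2"] sum_nonneg) auto
    finally have "(u g - u f)\<^sup>2 \<le> 1 / c f g * (\<Sum>a\<in>I. \<Sum>b\<in>I. c a b * (u b - u a)\<^sup>2)"
      using step by (simp add: field_simps)
    moreover have "(u e - u g)\<^sup>2 \<le> 2 * (u e - u f)\<^sup>2 + 2 * (u g - u f)\<^sup>2"
      using sum_squares_bound[of "u e - u f" "u f - u g"]
      by (simp add: power2_eq_square algebra_simps)
    ultimately show ?thesis using C(2)[of u] by (simp add: distrib_right)
  qed
  then show ?case using C(1) step by (intro exI[of _ "2 * C + 2 / c f g"]) auto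
qed

text \<open>The variance identity: mean of squares minus square of the mean, up to factors of the
  total mass. It reduces the derivative of the variance to those of the two moments.\<close>

lemma sum_sum_squared_difference:
  fixes m u :: "'i \<Rightarrow> real"
  shows "(\<Sum>e\<in>I. \<Sum>g\<in>I. m e * m g * (u e - u g)\<^sup>2)
    = 2 * (sum m I) * (\<Sum>e\<in>I. m e * (u e)\<^sup>2) - 2 * (\<Sum>e\<in>I. m e * u e)\<^sup>2"
proof -
  have "(\<Sum>e\<in>I. \<Sum>g\<in>I. m e * m g * (u e - u g)\<^sup>2)
    = (\<Sum>e\<in>I. \<Sum>g\<in>I. (m e * (u e)\<^sup>2) * m g) + (\<Sum>e\<in>I. \<Sum>g\<in>I. m e * (m g * (u g)\<^sup>2))
      - 2 * (\<Sum>e\<in>I. \<Sum>g\<in>I. (m e * u e) * (m g * u g))"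
    unfolding sum_distrib_left sum.distrib[symmetric] sum_subtractf[symmetric]
    by (intro sum.cong refl) (simp add: power2_eq_square algebra_simps)
  then show ?thesis
    by (simp only: sum_product[symmetric]) (simp add: power2_eq_square algebra_simps)
qed

text \<open>Summation by parts: exchange the two summation indices and use the symmetry of
  \<open>c\<close>. The first identity yields conservation of mass under the heat flow, the second
  the dissipation of energy.\<close>

lemma sum_sum_antisymmetric:
  fixes c :: "'i \<Rightarrow> 'i \<Rightarrow> real"
  assumes sym: "\<And>e f. c e f = c f e"
  shows "(\<Sum>e\<in>I. \<Sum>f\<in>I. c e f * (u f - u e)) = 0"
    and "2 * (\<Sum>e\<in>I. u e * (\<Sum>f\<in>I. c e f * (u f - u e))) = - (\<Sum>e\<in>I. \<Sum>f\<in>I. c e f * (u f - u e)\<^sup>2)"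
proof -
  have "(\<Sum>e\<in>I. \<Sum>f\<in>I. c e f * u f) = (\<Sum>e\<in>I. \<Sum>f\<in>I. c e f * u e)"
    by (subst sum.swap) (simp add: sym)
  then show "(\<Sum>e\<in>I. \<Sum>f\<in>I. c e f * (u f - u e)) = 0"
    by (simp add: algebra_simps sum_subtractf)
  have "(\<Sum>e\<in>I. \<Sum>f\<in>I. u f * (c e f * (u f - u e))) = (\<Sum>e\<in>I. \<Sum>f\<in>I. u e * (c e f * (u e - u f)))"
    by (subst sum.swap) (simp add: sym)
  then have "(\<Sum>e\<in>I. \<Sum>f\<in>I. u e * (c e f * (u f - u e))) = - (\<Sum>e\<in>I. \<Sum>f\<in>I. u f * (c e f * (u f - u e)))"
    by (simp add: algebra_simps sum_subtractf)
  moreover have "(\<Sum>e\<in>I. \<Sum>f\<in>I. c e f * (u f - u e)\<^sup>2)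
    = (\<Sum>e\<in>I. \<Sum>f\<in>I. u f * (c e f * (u f - u e))) - (\<Sum>e\<in>I. \<Sum>f\<in>I. u e * (c e f * (u f - u e)))"
    unfolding sum_subtractf[symmetric] by (intro sum.cong refl) (simp add: power2_eq_square algebra_simps)
  ultimately show "2 * (\<Sum>e\<in>I. u e * (\<Sum>f\<in>I. c e f * (u f - u e))) = - (\<Sum>e\<in>I. \<Sum>f\<in>I. c e f * (u f - u e)\<^sup>2)"
    by (simp add: sum_distrib_left)
qed

text \<open>Gronwall's argument: \<open>F t * exp (g * t)\<close> is nonincreasing. The comparison
  starts at time 1 because the differential inequality holds only for positive times.\<close>

lemma tendsto_0_if_deriv_le:
  fixes F F' :: "real \<Rightarrow> real"
  assumes g: "g > 0" and nn: "\<And>t. t > 0 \<Longrightarrow> F t \<ge> 0"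
    and der: "\<And>t. t > 0 \<Longrightarrow> (F has_real_derivative F' t) (at t)"
    and le: "\<And>t. t > 0 \<Longrightarrow> F' t \<le> - g * F t"
  shows "(F \<longlongrightarrow> 0) at_top"
proof (rule tendsto_sandwich)
  have "F t \<le> F 1 * exp g * exp (- g * t)" if t: "t \<ge> 1" for t
  proof -
    have "F t * exp (g * t) \<le> F 1 * exp (g * 1)"
    proof (rule DERIV_nonpos_imp_nonincreasing[OF t])
      fix s :: real assume s: "1 \<le> s" "s \<le> t"
      then have "((\<lambda>t. F t * exp (g * t)) has_real_derivative F' s * exp (g * s) + F s * (g * exp (g * s))) (at s)"
        by (auto intro!: derivative_eq_intros der)
      moreover have "F' s * exp (g * s) + F s * (g * exp (g * s)) = (F' s + g * F s) * exp (g * s)"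
        by (simp add: algebra_simps)
      moreover have "(F' s + g * F s) * exp (g * s) \<le> 0"
        using le[of s] s by (intro mult_nonpos_nonneg) auto
      ultimately show "\<exists>y. ((\<lambda>t. F t * exp (g * t)) has_real_derivative y) (at s) \<and> y \<le> 0" by auto
    qed
    then show ?thesis by (simp add: exp_minus field_simps)
  qed
  then show "\<forall>\<^sub>F t in at_top. F t \<le> F 1 * exp g * exp (- g * t)"
    by (auto simp: eventually_at_top_linorder)
  show "\<forall>\<^sub>F t in at_top. 0 \<le> F t"
    using nn by (auto simp: eventually_at_top_dense)
  have "((\<lambda>t. exp (- g * t)) \<longlongrightarrow> 0) at_top"
    using g by (intro filterlim_compose[OF exp_at_bot] filterlim_tendsto_neg_mult_at_bot[OF tendsto_const] filterlim_ident) auto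
  then show "((\<lambda>t. F 1 * exp g * exp (- g * t)) \<longlongrightarrow> 0) at_top"
    by (rule tendsto_mult_right_zero)
qed simp

text \<open>The mass \<open>S\<close> is conserved and the second moment \<open>Q\<close> decreases
  at rate \<open>D\<close>. A Poincare inequality bounds the variance \<open>F\<close> by a multiple
  of \<open>D\<close>, so \<open>F\<close> decays exponentially and all coordinates approach the
  conserved mean. Time 1 serves as reference since nothing is assumed at time 0.\<close>

lemma heat_flow_tendsto_mean:
  fixes m :: "'i \<Rightarrow> real" and c :: "'i \<Rightarrow> 'i \<Rightarrow> real" and u :: "real \<Rightarrow> 'i \<Rightarrow> real"
  assumes fin: "finite I"
    and m: "\<And>e. e \<in> I \<Longrightarrow> m e > 0"
    and sym: "\<And>e f. c e f = c f e"
    and nonneg: "\<And>e f. e \<in> I \<Longrightarrow> f \<in> I \<Longrightarrow> e \<noteq> f \<Longrightarrow> c e f \<ge> 0"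
    and conn: "\<And>e f. e \<in> I \<Longrightarrow> f \<in> I \<Longrightarrow> (\<lambda>e f. e \<in> I \<and> f \<in> I \<and> e \<noteq> f \<and> c e f > 0)\<^sup>*\<^sup>* e f"
    and der: "\<And>t e. t > 0 \<Longrightarrow> e \<in> I \<Longrightarrow>
      ((\<lambda>t. u t e) has_real_derivative (\<Sum>f\<in>I. c e f * (u t f - u t e)) / m e) (at t)"
    and e: "e \<in> I"
  shows "((\<lambda>t. u t e) \<longlongrightarrow> (\<Sum>f\<in>I. m f * u 1 f) / sum m I) at_top"
proof -
  define D where "D u = (\<Sum>e\<in>I. \<Sum>f\<in>I. c e f * (u f - u e)\<^sup>2)" for u :: "'i \<Rightarrow> real"
  define M where "M = sum m I"
  define S where "S t = (\<Sum>e\<in>I. m e * u t e)" for t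
  define Q where "Q t = (\<Sum>e\<in>I. m e * (u t e)\<^sup>2)" for t
  define F where "F t = (\<Sum>e\<in>I. \<Sum>g\<in>I. m e * m g * (u t e - u t g)\<^sup>2)" for t
  have M: "M > 0" using fin m e by (auto simp: M_def intro!: sum_pos)
  have F: "F t = 2 * M * Q t - 2 * (S t)\<^sup>2" for t
    by (simp add: F_def M_def Q_def S_def sum_sum_squared_difference)
  have S': "(S has_real_derivative 0) (at t)" if t: "t > 0" for t
  proof -
    have "(S has_real_derivative (\<Sum>e\<in>I. m e * ((\<Sum>f\<in>I. c e f * (u t f - u t e)) / m e))) (at t)"
      unfolding S_def by (intro DERIV_sum DERIV_cmult der t)
    also have "(\<Sum>e\<in>I. m e * ((\<Sum>f\<in>I. c e f * (u t f - u t e)) / m e)) = (\<Sum>e\<in>I. \<Sum>f\<in>I. c e f * (u t f - u t e))"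
      using m by (intro sum.cong refl) (auto dest: m)
    also have "\<dots> = 0" by (rule sum_sum_antisymmetric[OF sym])
    finally show ?thesis .
  qed
  \<comment> \<open>The open interval from 0 to \<open>t + 2\<close> contains both \<open>t\<close>
    and 1.\<close>
  have S1: "S t = S 1" if "t > 0" for t
    by (rule DERIV_isconst3[of 0 "t + 2"]) (use that S' in auto)
  have Q': "(Q has_real_derivative - D (u t)) (at t)" if t: "t > 0" for t
  proof -
    have "(Q has_real_derivative (\<Sum>e\<in>I. m e * (2 * u t e * ((\<Sum>f\<in>I. c e f * (u t f - u t e)) / m e)))) (at t)"
      unfolding Q_def using der[OF t]
      by (intro DERIV_sum DERIV_cmult) (auto intro!: derivative_eq_intros)
    also have "(\<Sum>e\<in>I. m e * (2 * u t e * ((\<Sum>f\<in>I. c e f * (u t f - u t e)) / m e)))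
      = 2 * (\<Sum>e\<in>I. u t e * (\<Sum>f\<in>I. c e f * (u t f - u t e)))"
      unfolding sum_distrib_left[of 2] by (intro sum.cong refl) (use m in force)
    also have "\<dots> = - D (u t)" unfolding D_def by (rule sum_sum_antisymmetric[OF sym])
    finally show ?thesis .
  qed
  have "\<forall>z\<in>I\<times>I. \<exists>C\<ge>0. \<forall>u. (u (fst z) - u (snd z))\<^sup>2 \<le> C * D u"
    using ex_difference_le_dirichlet[where c=c, OF fin nonneg conn] unfolding D_def by auto
  then obtain C where C: "\<And>z. z \<in> I \<times> I \<Longrightarrow> C z \<ge> 0"
    "\<And>z u. z \<in> I \<times> I \<Longrightarrow> (u (fst z) - u (snd z))\<^sup>2 \<le> C z * D u" by metis
  \<comment> \<open>The added 1 keeps \<open>P\<close> positive even when all constants vanish, for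
    instance if \<open>I\<close> is a singleton.\<close>
  define P where "P = (\<Sum>e\<in>I. \<Sum>g\<in>I. m e * m g * C (e, g)) + 1"
  have P: "P > 0" using m C(1) unfolding P_def
    by (intro add_nonneg_pos sum_nonneg mult_nonneg_nonneg) (auto intro: less_imp_le)
  have D0: "D w \<ge> 0" for w
    using nonneg unfolding D_def by (intro sum_nonneg) (metis diff_self mult_nonneg_nonneg mult_zero_right order.refl power_zero_numeral zero_le_power2)
  have poincare: "F t \<le> P * D (u t)" for t
  proof -
    have "F t \<le> (\<Sum>e\<in>I. \<Sum>g\<in>I. m e * m g * (C (e, g) * D (u t)))"
      unfolding F_def using m C(2)[of "(_,_)"] by (intro sum_mono mult_left_mono) (auto intro: less_imp_le)
    also have "\<dots> = (P - 1) * D (u t)" by (simp add: P_def sum_distrib_right mult.assoc)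
    also have "\<dots> \<le> P * D (u t)" using D0 by (intro mult_right_mono) auto
    finally show ?thesis .
  qed
  have "(F \<longlongrightarrow> 0) at_top"
  proof (rule tendsto_0_if_deriv_le)
    show "2 * M / P > 0" using M P by simp
    show "F t \<ge> 0" for t
      unfolding F_def using m by (intro sum_nonneg mult_nonneg_nonneg) (auto intro: less_imp_le)
    show "(F has_real_derivative - 2 * M * D (u t)) (at t)" if "t > 0" for t
      unfolding F using Q'[OF that] S'[OF that] by (auto intro!: derivative_eq_intros)
    show "- 2 * M * D (u t) \<le> - (2 * M / P) * F t" for t
      using poincare[of t] M P by (simp add: field_simps)
  qed
  have diff: "((\<lambda>t. u t e - u t g) \<longlongrightarrow> 0) at_top" if g: "g \<in> I" for g
  proof -
    have "m e * m g * (u t e - u t g)\<^sup>2 \<le> F t" for t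
    proof -
      have nn: "m a * m b * (u t a - u t b)\<^sup>2 \<ge> 0" if "a \<in> I" "b \<in> I" for a b
        using m[OF that(1)] m[OF that(2)] by simp
      have "m e * m g * (u t e - u t g)\<^sup>2 \<le> (\<Sum>b\<in>I. m e * m b * (u t e - u t b)\<^sup>2)"
        using g e fin nn by (intro member_le_sum[of g I "\<lambda>b. m e * m b * (u t e - u t b)\<^sup>2"]) auto
      also have "\<dots> \<le> F t" unfolding F_def
        using e fin nn by (intro member_le_sum[of e I "\<lambda>a. \<Sum>b\<in>I. m a * m b * (u t a - u t b)\<^sup>2"] sum_nonneg) auto
      finally show ?thesis .
    qed
    then have le: "(u t e - u t g)\<^sup>2 \<le> F t / (m e * m g)" for t
      using m[OF e] m[OF g] by (simp add: field_simps)
    have "((\<lambda>t. (u t e - u t g)\<^sup>2) \<longlongrightarrow> 0) at_top"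
      by (rule tendsto_sandwich[of "\<lambda>_. 0" _ _ "\<lambda>t. F t / (m e * m g)"])
        (use le \<open>(F \<longlongrightarrow> 0) at_top\<close> in \<open>auto intro: tendsto_divide_zero\<close>)
    then show ?thesis by (simp add: power_tendsto_0_iff)
  qed
  \<comment> \<open>A coordinate is its weighted average deviation from the others plus the
    conserved mean; the deviations tend to 0.\<close>
  have "((\<lambda>t. (\<Sum>g\<in>I. m g * (u t e - u t g)) / M + S 1 / M) \<longlongrightarrow> (\<Sum>g\<in>I. m g * 0) / M + S 1 / M) at_top"
    using M by (intro tendsto_intros diff) auto
  moreover have "\<forall>\<^sub>F t in at_top. (\<Sum>g\<in>I. m g * (u t e - u t g)) / M + S 1 / M = u t e"
    using eventually_gt_at_top[of 0]
  proof eventually_elim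
    case (elim t)
    have "(\<Sum>g\<in>I. m g * (u t e - u t g)) = M * u t e - S 1"
      using S1[OF elim] by (simp add: S_def M_def right_diff_distrib sum_subtractf sum_distrib_right)
    then show ?case using M by (simp add: field_simps)
  qed
  ultimately show ?thesis
    by (subst (asm) tendsto_cong) (auto simp: S_def M_def)
qed

text \<open>A ground state transform: dividing \<open>w\<close> by the growth factor and the Perron
  vector removes the zeroth-order term, by the eigenvalue equation. What remains is a heat equation
  with masses \<open>p e * (v e)^2\<close> and conductances \<open>p e * B e f * v e * v f\<close>,
  symmetric by \<open>sym\<close>. The limit mean is absorbed into the final eigenvector.\<close>

lemma symmetrizable_flow_asymptotics:
  fixes p :: "'i \<Rightarrow> real" and B :: "'i \<Rightarrow> 'i \<Rightarrow> real" and w :: "real \<Rightarrow> 'i \<Rightarrow> real"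
  assumes fin: "finite I" and ne: "I \<noteq> {}"
    and p: "\<And>e. e \<in> I \<Longrightarrow> p e > 0"
    and sym: "\<And>e f. p e * B e f = p f * B f e"
    and nonneg: "\<And>e f. e \<in> I \<Longrightarrow> f \<in> I \<Longrightarrow> e \<noteq> f \<Longrightarrow> B e f \<ge> 0"
    and conn: "\<And>e f. e \<in> I \<Longrightarrow> f \<in> I \<Longrightarrow> (\<lambda>e f. e \<in> I \<and> f \<in> I \<and> e \<noteq> f \<and> B e f > 0)\<^sup>*\<^sup>* e f"
    and pos: "\<And>t e. t > 0 \<Longrightarrow> e \<in> I \<Longrightarrow> w t e > 0"
    and der: "\<And>t e. t > 0 \<Longrightarrow> e \<in> I \<Longrightarrow>
      ((\<lambda>t. w t e) has_real_derivative (\<Sum>f\<in>I. B e f * w t f)) (at t)"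
  shows "\<exists>l v. (\<forall>e\<in>I. v e > 0) \<and> (\<forall>e\<in>I. (\<Sum>f\<in>I. B e f * v f) = l * v e) \<and>
    (\<forall>e\<in>I. ((\<lambda>t. exp (- l * t) * w t e) \<longlongrightarrow> v e) at_top)"
proof -
  have conn': "(\<lambda>e f. e \<in> I \<and> f \<in> I \<and> e \<noteq> f \<and> p e * B e f > 0)\<^sup>*\<^sup>* e f" if "e \<in> I" "f \<in> I" for e f
    by (rule rtranclp_mono[THEN predicate2D, OF _ conn[OF that]]) (use p in auto)
  have "p e * B e f \<ge> 0" if "e \<in> I" "f \<in> I" "e \<noteq> f" for e f
    using p[of e] nonneg[of e f] that by simp
  from ex_perron_vector[of I p "\<lambda>e f. p e * B e f", OF fin ne p sym this conn']
  obtain l v where v: "\<And>e. e \<in> I \<Longrightarrow> v e > 0"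
    and l: "\<And>e. e \<in> I \<Longrightarrow> (\<Sum>f\<in>I. p e * B e f * v f) = l * p e * v e"
    by blast
  have eig: "(\<Sum>f\<in>I. B e f * v f) = l * v e" if "e \<in> I" for e
  proof -
    have "p e * (\<Sum>f\<in>I. B e f * v f) = p e * (l * v e)"
      using l[OF that] by (simp add: sum_distrib_left mult_ac)
    then show ?thesis using p[OF that] by simp
  qed
  define m where "m e = p e * (v e)\<^sup>2" for e
  define c where "c e f = p e * B e f * v e * v f" for e f
  define u where "u t e = exp (- l * t) * w t e / v e" for t e
  define a where "a = (\<Sum>f\<in>I. m f * u 1 f) / sum m I"
  have m: "m e > 0" if "e \<in> I" for e using p[OF that] v[OF that] by (simp add: m_def)
  have "m f * u 1 f > 0" if "f \<in> I" for f
    using m[OF that] v[OF that] pos[of 1 f] that by (simp add: u_def)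
  \<comment> \<open>The limit is positive because it is a weighted mean of the positive values at
    time 1.\<close>
  then have a: "a > 0" using fin ne m by (auto simp: a_def intro!: divide_pos_pos sum_pos)
  have u: "((\<lambda>t. u t e) \<longlongrightarrow> a) at_top" if e: "e \<in> I" for e
    unfolding a_def
  proof (rule heat_flow_tendsto_mean[where c = c, OF fin m _ _ _ _ e])
    show "c e f = c f e" for e f using sym[of e f] by (simp add: c_def)
    show "c e f \<ge> 0" if "e \<in> I" "f \<in> I" "e \<noteq> f" for e f
      using that p[of e] nonneg[of e f] v[of e] v[of f] by (simp add: c_def)
    show "(\<lambda>e f. e \<in> I \<and> f \<in> I \<and> e \<noteq> f \<and> 0 < c e f)\<^sup>*\<^sup>* e f" if "e \<in> I" "f \<in> I" for e f
      by (rule rtranclp_mono[THEN predicate2D, OF _ conn'[OF that]]) (use v in \<open>auto simp: c_def\<close>)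
    show "((\<lambda>t. u t e) has_real_derivative (\<Sum>f\<in>I. c e f * (u t f - u t e)) / m e) (at t)"
      if t: "t > 0" and e: "e \<in> I" for t e
    proof -
      have "(\<Sum>f\<in>I. c e f * (u t f - u t e))
        = (\<Sum>f\<in>I. p e * exp (- l * t) * (v e * (B e f * w t f) - w t e * (B e f * v f)))"
      proof (intro sum.cong refl)
        fix f assume "f \<in> I"
        then show "c e f * (u t f - u t e)
          = p e * exp (- l * t) * (v e * (B e f * w t f) - w t e * (B e f * v f))"
          using v[OF e] v[of f] by (simp add: c_def u_def field_simps)
      qed
      also have "\<dots> = p e * exp (- l * t) * (v e * (\<Sum>f\<in>I. B e f * w t f) - w t e * (l * v e))"
        unfolding sum_distrib_left[symmetric] sum_subtractf eig[OF e] ..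
      finally have "(\<Sum>f\<in>I. c e f * (u t f - u t e)) / m e
        = (exp (- l * t) * (\<Sum>f\<in>I. B e f * w t f) - l * exp (- l * t) * w t e) / v e"
        using v[OF e] p[OF e] by (simp add: m_def field_simps power2_eq_square)
      moreover have "((\<lambda>t. u t e) has_real_derivative
          (exp (- l * t) * (\<Sum>f\<in>I. B e f * w t f) - l * exp (- l * t) * w t e) / v e) (at t)"
        unfolding u_def by (rule DERIV_cdivide) (auto intro!: derivative_eq_intros der t e)
      ultimately show ?thesis by simp
    qed
  qed
  have "((\<lambda>t. exp (- l * t) * w t e) \<longlongrightarrow> a * v e) at_top" if e: "e \<in> I" for e
    using tendsto_mult_right[OF u[OF e], of "v e"] v[OF e] by (simp add: u_def)
  moreover have "(\<Sum>f\<in>I. B e f * (a * v f)) = l * (a * v e)" if "e \<in> I" for e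
    using arg_cong[OF eig[OF that], of "\<lambda>x. a * x"] by (simp add: sum_distrib_left mult_ac)
  ultimately show ?thesis using a v by (intro exI[of _ l] exI[of _ "\<lambda>e. a * v e"]) auto
qed

section \<open>Curvature of weighted trees\<close>

lemma walk_Cons: "adjacent E a b \<Longrightarrow> walk E b xs c \<Longrightarrow> walk E a (a # xs) c"
  by (cases xs) (auto simp: walk_def)

lemma walk_length_Cons: "xs \<noteq> [] \<Longrightarrow> walk_length \<omega> (a # xs) = \<omega> {a, hd xs} + walk_length \<omega> xs"
  by (cases xs) (simp_all add: walk_length_def sum.lessThan_Suc_shift del: sum.lessThan_Suc)

lemma walk_induct [consumes 1, case_names single step]:
  assumes "walk E u xs v"
    and "\<And>u. P u [u] u"
    and "\<And>a b xs c. adjacent E a b \<Longrightarrow> walk E b xs c \<Longrightarrow> P b xs c \<Longrightarrow> P a (a # xs) c"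
  shows "P u xs v"
  using assms(1)
proof (induction xs arbitrary: u)
  case Nil
  then show ?case by (simp add: walk_def)
next
  case (Cons a xs)
  show ?case
  proof (cases xs)
    case Nil
    then show ?thesis using Cons.prems assms(2) by (auto simp: walk_def)
  next
    case (Cons b ys)
    then have "adjacent E a b" "walk E b xs v" "u = a"
      using Cons.prems by (auto simp: walk_def)
    then show ?thesis using Cons.IH assms(3) by blast
  qed
qed

text \<open>Telescoping along the walk. Every lower bound on a distance below comes from a suitable
  1-Lipschitz \<open>f\<close>.\<close>

lemma diff_le_walk_length:
  assumes "walk E u xs v" and "\<And>a b. adjacent E a b \<Longrightarrow> f a - f b \<le> \<omega> {a, b}"
  shows "f u - f v \<le> walk_length \<omega> xs"
  using assms(1)
proof (induction rule: walk_induct)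
  case (single u)
  then show ?case by (simp add: walk_length_def)
next
  case (step a b xs c)
  then show ?case using assms(2)[of a b] by (auto simp: walk_length_Cons walk_def)
qed

text \<open>Loop erasure: if the new starting point already lies on the path, only the suffix from
  there is kept.\<close>

lemma rtranclp_imp_distinct_path:
  assumes "R\<^sup>*\<^sup>* a b"
  shows "\<exists>xs. xs \<noteq> [] \<and> hd xs = a \<and> last xs = b \<and> distinct xs \<and> successively R xs"
  using assms
proof (induction rule: converse_rtranclp_induct)
  case base
  then show ?case by (intro exI[of _ "[b]"]) simp
next
  case (step a c)
  then obtain xs where xs: "xs \<noteq> []" "hd xs = c" "last xs = b" "distinct xs" "successively R xs" by blast
  show ?case
  proof (cases "a \<in> set xs")
    case True
    then obtain ys zs where "xs = ys @ a # zs" by (auto dest: split_list)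
    then show ?thesis using xs by (intro exI[of _ "a # zs"]) (auto simp: successively_append_iff)
  next
    case False
    then show ?thesis using xs step by (intro exI[of _ "a # xs"]) (cases xs; auto)
  qed
qed

text \<open>A repetition-free path avoiding the edge would close up with it to a cycle.\<close>

lemma not_connected_without_edge:
  assumes "\<nexists>xs. graph_cycle E xs" "{x, y} \<in> E" "x \<noteq> y"
  shows "\<not> (adjacent (E - {{x, y}}))\<^sup>*\<^sup>* x y"
proof
  assume "(adjacent (E - {{x, y}}))\<^sup>*\<^sup>* x y"
  then obtain xs where xs: "xs \<noteq> []" "hd xs = x" "last xs = y" "distinct xs"
    "successively (adjacent (E - {{x, y}})) xs"
    by (blast dest: rtranclp_imp_distinct_path)
  have "successively (adjacent E) xs"
    using xs(5) by (rule successively_mono) (auto simp: adjacent_def)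
  \<comment> \<open>One vertex would force \<open>x = y\<close>, and two vertices would use the
    deleted edge.\<close>
  moreover have "length xs \<ge> 3"
  proof (rule ccontr)
    assume "\<not> length xs \<ge> 3"
    then consider a where "xs = [a]" | a b where "xs = [a, b]"
      using xs(1) by (cases xs; cases "tl xs"; cases "tl (tl xs)") auto
    then show False using xs assms(3) by cases (auto simp: adjacent_def)
  qed
  ultimately have "graph_cycle E xs"
    using xs assms(2) by (simp add: graph_cycle_def adjacent_def insert_commute)
  then show False using assms(1) by blast
qed

section \<open>Step measures, couplings and the matrix of the flow\<close>

locale measured_tree =
  fixes V :: "'a set" and E :: "'a set set" and m1 :: "'a \<Rightarrow> real" and m2 :: "'a set \<Rightarrow> real"
  assumes tree: "finite_tree V E"
    and m1_pos: "\<And>x. x \<in> V \<Longrightarrow> m1 x > 0"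
    and m2_pos: "\<And>e. e \<in> E \<Longrightarrow> m2 e > 0"
begin

lemma finite_V: "finite V" using tree by (simp add: finite_tree_def)

lemma edgeD: "e \<in> E \<Longrightarrow> \<exists>x\<in>V. \<exists>y\<in>V. x \<noteq> y \<and> e = {x, y}"
  using tree by (simp add: finite_tree_def simple_graph_def)

lemma edge_subset: "e \<in> E \<Longrightarrow> e \<subseteq> V"
  using edgeD by blast

lemma adjacentD: assumes "{x, y} \<in> E" shows "x \<in> V" "y \<in> V" "x \<noteq> y"
  using edgeD[OF assms] by (metis doubleton_eq_iff)+

lemma finite_E: "finite E"
  by (rule finite_subset[of _ "Pow V"]) (use finite_V edge_subset in auto)

abbreviation N :: "'a \<Rightarrow> 'a set" where "N x \<equiv> {y. adjacent E x y}"

lemma N_subset: "N x \<subseteq> V" using adjacentD by (auto simp: adjacent_def)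

lemma finite_N: "finite (N x)" using finite_subset[OF N_subset finite_V] .

lemma ex_walk: "u \<in> V \<Longrightarrow> v \<in> V \<Longrightarrow> \<exists>xs. walk E u xs v"
  using tree by (auto simp: finite_tree_def connected_graph_def)

definition lap :: "'a \<Rightarrow> ('a \<Rightarrow> real) \<Rightarrow> real" where
  "lap x g = 1 / m1 x * (\<Sum>z\<in>N x. m2 {x, z} * (g z - g x))"

text \<open>The step measure is affine in \<open>\<epsilon>\<close>, so its expectations are given
  by the graph Laplacian \<open>lap\<close> without an error term. Constant \<open>g\<close> shows
  that the total mass is 1.\<close>

lemma sum_step_measure:
  assumes "x \<in> V"
  shows "(\<Sum>u\<in>V. g u * step_measure E m1 m2 \<epsilon> x u) = g x + \<epsilon> * lap x g"
proof -
  have nadj: "\<not> adjacent E x x" using adjacentD(3)[of x x] by (auto simp: adjacent_def)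
  have "(\<Sum>u\<in>V. g u * step_measure E m1 m2 \<epsilon> x u)
    = (\<Sum>u\<in>V. (if u = x then g x * (1 - \<epsilon> * weighted_degree E m1 m2 x) else 0)
        + (if u \<in> N x then g u * (\<epsilon> * m2 {x, u} / m1 x) else 0))"
    using nadj by (intro sum.cong refl) (auto simp: step_measure_def)
  also have "\<dots> = g x * (1 - \<epsilon> * weighted_degree E m1 m2 x) + (\<Sum>u\<in>V \<inter> N x. g u * (\<epsilon> * m2 {x, u} / m1 x))"
    using assms finite_V by (simp add: sum.distrib sum.inter_restrict cong: if_cong)
  also have "V \<inter> N x = N x" using N_subset by blast
  also have "(\<Sum>u\<in>N x. g u * (\<epsilon> * m2 {x, u} / m1 x)) = \<epsilon> / m1 x * (\<Sum>u\<in>N x. m2 {x, u} * g u)"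
    unfolding sum_distrib_left by (intro sum.cong refl) simp
  finally show ?thesis
    by (simp add: lap_def weighted_degree_def right_diff_distrib sum_subtractf sum_distrib_left[symmetric]
        sum_distrib_right[symmetric])
qed

text \<open>The easy half of Kantorovich duality: integrate the Lipschitz inequality against the
  coupling and evaluate both marginals.\<close>

lemma wasserstein_ge:
  assumes "x \<in> V" "y \<in> V"
    and lip: "\<And>u v. u \<in> V \<Longrightarrow> v \<in> V \<Longrightarrow> f u - f v \<le> d u v"
    and A: "coupling V (step_measure E m1 m2 \<epsilon> x) (step_measure E m1 m2 \<epsilon> y) A"
  shows "(f x + \<epsilon> * lap x f) - (f y + \<epsilon> * lap y f) \<le> (\<Sum>u\<in>V. \<Sum>v\<in>V. d u v * A u v)"
proof -
  have "f x + \<epsilon> * lap x f = (\<Sum>u\<in>V. \<Sum>v\<in>V. f u * A u v)"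
    using A by (simp add: sum_step_measure[OF assms(1), symmetric] coupling_def sum_distrib_left[symmetric])
  moreover have "f y + \<epsilon> * lap y f = (\<Sum>u\<in>V. \<Sum>v\<in>V. f v * A u v)"
    using A by (subst sum.swap)
      (simp add: sum_step_measure[OF assms(2), symmetric] coupling_def sum_distrib_left[symmetric])
  ultimately have "(f x + \<epsilon> * lap x f) - (f y + \<epsilon> * lap y f) = (\<Sum>u\<in>V. \<Sum>v\<in>V. (f u - f v) * A u v)"
    by (simp add: left_diff_distrib sum_subtractf)
  also have "\<dots> \<le> (\<Sum>u\<in>V. \<Sum>v\<in>V. d u v * A u v)"
    using A lip by (intro sum_mono mult_right_mono) (auto simp: coupling_def)
  finally show ?thesis .
qed

text \<open>With point masses at \<open>x\<close> and \<open>y\<close>, this is the sum of the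
  products \<open>\<mu>_x * \<delta>_y\<close> and \<open>\<delta>_x * \<mu>_y\<close> minus
  \<open>\<delta>_x * \<delta>_y\<close>: every transported unit starts at \<open>x\<close> or ends
  at \<open>y\<close>.\<close>

definition edge_coupling :: "real \<Rightarrow> 'a \<Rightarrow> 'a \<Rightarrow> 'a \<Rightarrow> 'a \<Rightarrow> real" where
  "edge_coupling \<epsilon> x y u v = (if v = y then step_measure E m1 m2 \<epsilon> x u else 0)
     + (if u = x then step_measure E m1 m2 \<epsilon> y v else 0) - (if u = x \<and> v = y then 1 else 0)"

text \<open>The marginals are right because both measures have mass 1. Only the entry at
  \<open>(x, y)\<close> could be negative; it is 1 minus the left side of
  \<open>small\<close>.\<close>

lemma coupling_edge_coupling:
  assumes e: "{x, y} \<in> E" and "\<epsilon> \<ge> 0"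
    and small: "\<epsilon> * (weighted_degree E m1 m2 x + weighted_degree E m1 m2 y) \<le> 1"
  shows "coupling V (step_measure E m1 m2 \<epsilon> x) (step_measure E m1 m2 \<epsilon> y) (edge_coupling \<epsilon> x y)"
proof -
  note V = adjacentD[OF e]
  have one: "(\<Sum>u\<in>V. step_measure E m1 m2 \<epsilon> z u) = 1" if "z \<in> V" for z
    using sum_step_measure[OF that, of "\<lambda>_. 1"] by (simp add: lap_def)
  have nn: "step_measure E m1 m2 \<epsilon> z u \<ge> 0" if "z \<in> V" "u \<noteq> z" for z u
    using that m1_pos[of z] m2_pos[of "{z, u}"] \<open>\<epsilon> \<ge> 0\<close>
    by (auto simp: step_measure_def adjacent_def intro!: divide_nonneg_nonneg mult_nonneg_nonneg intro: less_imp_le)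
  have "edge_coupling \<epsilon> x y u v \<ge> 0" for u v
    using nn[of x u] nn[of y v] V small
    by (auto simp: edge_coupling_def) (simp add: step_measure_def algebra_simps)
  moreover have "(\<Sum>v\<in>V. edge_coupling \<epsilon> x y u v) = step_measure E m1 m2 \<epsilon> x u" for u
    using V finite_V one[of y] by (cases "u = x") (simp_all add: edge_coupling_def sum.distrib sum_subtractf)
  moreover have "(\<Sum>u\<in>V. edge_coupling \<epsilon> x y u v) = step_measure E m1 m2 \<epsilon> y v" for v
    using V finite_V one[of x] by (cases "v = y") (simp_all add: edge_coupling_def sum.distrib sum_subtractf)
  ultimately show ?thesis by (simp add: coupling_def)
qed

lemma cost_edge_coupling:
  assumes "x \<in> V" "y \<in> V"
  shows "(\<Sum>u\<in>V. \<Sum>v\<in>V. d u v * edge_coupling \<epsilon> x y u v)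
    = d x y + \<epsilon> * (lap x (\<lambda>u. d u y) + lap y (d x))"
proof -
  have "(\<Sum>u\<in>V. \<Sum>v\<in>V. d u v * edge_coupling \<epsilon> x y u v)
    = (\<Sum>u\<in>V. \<Sum>v\<in>V. if v = y then d u y * step_measure E m1 m2 \<epsilon> x u else 0)
      + (\<Sum>v\<in>V. \<Sum>u\<in>V. if u = x then d x v * step_measure E m1 m2 \<epsilon> y v else 0)
      - (\<Sum>u\<in>V. \<Sum>v\<in>V. if v = y then if u = x then d x y else 0 else 0)"
    by (subst (3) sum.swap, unfold sum.distrib[symmetric] sum_subtractf[symmetric])
      (auto simp: edge_coupling_def algebra_simps intro!: sum.cong)
  then show ?thesis
    using assms finite_V by (simp add: sum_step_measure algebra_simps)
qed

text \<open>The matrix \<open>B\<close> of the linear flow. Summing over \<open>e \<inter> f\<close>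
  treats disjoint and touching edges alike, without naming the shared vertex.\<close>

definition generator :: "'a set \<Rightarrow> 'a set \<Rightarrow> real" where
  "generator e f = (if e = f then - (\<Sum>v\<in>e. m2 e / m1 v) else (\<Sum>v\<in>e \<inter> f. m2 f / m1 v))"

lemma sum_incident_edges:
  assumes "{x, y} \<in> E"
  shows "(\<Sum>f\<in>{f \<in> E - {{x, y}}. x \<in> f}. h f) = (\<Sum>z\<in>N x - {y}. h {x, z})"
proof (rule sum.reindex_bij_betw[symmetric])
  show "bij_betw (\<lambda>z. {x, z}) (N x - {y}) {f \<in> E - {{x, y}}. x \<in> f}"
    unfolding bij_betw_def
  proof (intro conjI equalityI subsetI)
    show "inj_on (\<lambda>z. {x, z}) (N x - {y})" by (auto simp: inj_on_def doubleton_eq_iff)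
    fix f assume f: "f \<in> {f \<in> E - {{x, y}}. x \<in> f}"
    then obtain a b where "f = {a, b}" using edgeD by blast
    with f show "f \<in> (\<lambda>z. {x, z}) ` (N x - {y})"
      by (auto simp: adjacent_def insert_commute)
  qed (auto simp: adjacent_def doubleton_eq_iff)
qed

lemma sum_generator:
  assumes e: "{x, y} \<in> E"
  shows "(\<Sum>f\<in>E. generator {x, y} f * \<omega> f)
    = 1 / m1 x * ((\<Sum>z\<in>N x - {y}. m2 {x, z} * \<omega> {x, z}) - m2 {x, y} * \<omega> {x, y})
    + 1 / m1 y * ((\<Sum>z\<in>N y - {x}. m2 {y, z} * \<omega> {y, z}) - m2 {x, y} * \<omega> {x, y})"
proof -
  have ne: "x \<noteq> y" using adjacentD[OF e] by simp
  have "(\<Sum>f\<in>E - {{x, y}}. generator {x, y} f * \<omega> f)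
    = (\<Sum>f\<in>E - {{x, y}}. \<Sum>v | v \<in> {x, y} \<and> v \<in> f. m2 f / m1 v * \<omega> f)"
    by (intro sum.cong refl) (auto simp: generator_def sum_distrib_right Int_def)
  \<comment> \<open>Double counting: instead of common vertices per edge, sum over the edges at each
    of the two endpoints.\<close>
  also have "\<dots> = (\<Sum>v\<in>{x, y}. \<Sum>f\<in>{f \<in> E - {{x, y}}. v \<in> f}. m2 f / m1 v * \<omega> f)"
    using finite_E by (intro sum.swap_restrict) auto
  also have "\<dots> = (\<Sum>z\<in>N x - {y}. m2 {x, z} / m1 x * \<omega> {x, z}) + (\<Sum>z\<in>N y - {x}. m2 {y, z} / m1 y * \<omega> {y, z})"
  proof -
    have "(\<Sum>f\<in>{f \<in> E - {{x, y}}. y \<in> f}. m2 f / m1 y * \<omega> f) = (\<Sum>z\<in>N y - {x}. m2 {y, z} / m1 y * \<omega> {y, z})"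
      using sum_incident_edges[of y x "\<lambda>f. m2 f / m1 y * \<omega> f"] e unfolding insert_commute[of y x] by simp
    moreover have "(\<Sum>v\<in>{x, y}. F v) = F x + F y" for F :: "'a \<Rightarrow> real"
      using ne by simp
    ultimately show ?thesis by (simp only: sum_incident_edges[OF e])
  qed
  also have "\<dots> = 1 / m1 x * (\<Sum>z\<in>N x - {y}. m2 {x, z} * \<omega> {x, z}) + 1 / m1 y * (\<Sum>z\<in>N y - {x}. m2 {y, z} * \<omega> {y, z})"
    by (simp add: sum_distrib_left)
  finally show ?thesis
    using finite_E e ne by (simp add: sum.remove[of E "{x, y}"] generator_def algebra_simps)
qed

lemma generator_pos:
  assumes "e \<in> E" "f \<in> E" "e \<noteq> f" "e \<inter> f \<noteq> {}" shows "generator e f > 0"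
proof -
  have "e \<inter> f \<subseteq> V" using assms(1) by (auto dest: edge_subset)
  then show ?thesis using assms m1_pos m2_pos finite_subset[OF _ finite_V]
    by (auto simp: generator_def intro!: sum_pos divide_pos_pos)
qed

lemma generator_nonneg: "e \<in> E \<Longrightarrow> f \<in> E \<Longrightarrow> e \<noteq> f \<Longrightarrow> generator e f \<ge> 0"
  using generator_pos[of e f] by (cases "e \<inter> f = {}") (auto simp: generator_def)

lemma generator_symmetrizable: "m2 e * generator e f = m2 f * generator f e"
  by (auto simp: generator_def sum_distrib_left Int_commute mult.commute)

text \<open>Consecutive edges of a walk share a vertex and hence have a positive entry. The
  induction covers all edges at both ends of the walk, so that the first edge can be exchanged at
  each step.\<close>

lemma edges_connected:
  assumes "e \<in> E" "f \<in> E"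
  shows "(\<lambda>e f. e \<in> E \<and> f \<in> E \<and> e \<noteq> f \<and> generator e f > 0)\<^sup>*\<^sup>* e f"
proof -
  let ?R = "\<lambda>e f. e \<in> E \<and> f \<in> E \<and> e \<noteq> f \<and> generator e f > 0"
  have share: "?R\<^sup>*\<^sup>* e f" if "e \<in> E" "f \<in> E" "a \<in> e" "a \<in> f" for e f a
    using generator_pos[of e f] that by (cases "e = f") auto
  obtain a c where a: "a \<in> e" "a \<in> V" and c: "c \<in> f" "c \<in> V"
    using edgeD[OF assms(1)] edgeD[OF assms(2)] by blast
  obtain xs where "walk E a xs c" using ex_walk a c by blast
  then have "\<forall>e\<in>E. a \<in> e \<longrightarrow> (\<forall>f\<in>E. c \<in> f \<longrightarrow> ?R\<^sup>*\<^sup>* e f)"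
  proof (induction rule: walk_induct)
    case (single u)
    then show ?case using share by blast
  next
    case (step a b xs c)
    then have ab: "{a, b} \<in> E" by (simp add: adjacent_def)
    show ?case
    proof (intro ballI impI)
      fix e f assume ef: "e \<in> E" "a \<in> e" "f \<in> E" "c \<in> f"
      have "?R\<^sup>*\<^sup>* e {a, b}" using share[of e "{a, b}" a] ef ab by simp
      moreover have "?R\<^sup>*\<^sup>* {a, b} f" using step.IH ab ef by blast
      ultimately show "?R\<^sup>*\<^sup>* e f" by (rule rtranclp_trans)
    qed
  qed
  then show ?thesis using assms a c by blast
qed

end

section \<open>Distances, Wasserstein cost and curvature for a positive weight\<close>

locale weighted_tree = measured_tree +
  fixes \<omega> :: "'a set \<Rightarrow> real"
  assumes \<omega>_pos: "\<And>e. e \<in> E \<Longrightarrow> \<omega> e > 0"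
begin

abbreviation d :: "'a \<Rightarrow> 'a \<Rightarrow> real" where "d \<equiv> weighted_dist E \<omega>"

lemma walk_length_nonneg: "walk E u xs v \<Longrightarrow> walk_length \<omega> xs \<ge> 0"
  using diff_le_walk_length[of E u xs v "\<lambda>_. 0" \<omega>] \<omega>_pos by (simp add: adjacent_def less_imp_le)

lemma dist_le_walk_length:
  assumes "walk E u xs v" shows "d u v \<le> walk_length \<omega> xs"
  unfolding weighted_dist_def using assms walk_length_nonneg
  by (intro cInf_lower bdd_belowI[of _ 0]) auto

lemma le_dist:
  assumes "u \<in> V" "v \<in> V" "\<And>xs. walk E u xs v \<Longrightarrow> b \<le> walk_length \<omega> xs"
  shows "b \<le> d u v"
  unfolding weighted_dist_def using assms ex_walk[of u v] by (intro cInf_greatest) auto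

lemma dist_step:
  assumes "{a, b} \<in> E" "c \<in> V"
  shows "d a c \<le> \<omega> {a, b} + d b c"
proof -
  have "d a c - \<omega> {a, b} \<le> d b c"
  proof (rule le_dist)
    fix xs assume xs: "walk E b xs c"
    then have "d a c \<le> walk_length \<omega> (a # xs)"
      using assms by (intro dist_le_walk_length walk_Cons) (auto simp: adjacent_def)
    then show "d a c - \<omega> {a, b} \<le> walk_length \<omega> xs"
      using xs by (simp add: walk_length_Cons walk_def)
  qed (use assms adjacentD in auto)
  then show ?thesis by simp
qed

lemma dist_self: "x \<in> V \<Longrightarrow> d x x = 0"
  using dist_le_walk_length[of x "[x]" x] le_dist[of x x 0] walk_length_nonneg
  by (force simp: walk_def walk_length_def)

definition side :: "'a \<Rightarrow> 'a \<Rightarrow> 'a set" where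
  "side x y = {u. (adjacent (E - {{x, y}}))\<^sup>*\<^sup>* x u}"

lemma side_self: "x \<in> side x y" by (simp add: side_def)

lemma not_in_side: "{x, y} \<in> E \<Longrightarrow> y \<notin> side x y"
  using not_connected_without_edge[of E x y] tree adjacentD by (auto simp: side_def finite_tree_def)

lemma side_step: "u \<in> side x y \<Longrightarrow> {u, v} \<in> E \<Longrightarrow> {u, v} \<noteq> {x, y} \<Longrightarrow> v \<in> side x y"
  unfolding side_def mem_Collect_eq
  by (erule rtranclp.rtrancl_into_rtrancl) (simp add: adjacent_def)

lemma diff_le_dist:
  assumes "u \<in> V" "v \<in> V" "\<And>a b. adjacent E a b \<Longrightarrow> f a - f b \<le> \<omega> {a, b}"
  shows "f u - f v \<le> d u v"
  using assms by (intro le_dist diff_le_walk_length) auto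

text \<open>Since \<open>{x, y}\<close> is a bridge, the indicator of \<open>side x y\<close> scaled
  by its weight jumps only across this edge. It is thus 1-Lipschitz and shows that no walk from
  \<open>x\<close> to \<open>y\<close> is shorter than the edge.\<close>

lemma dist_adjacent:
  assumes e: "{x, y} \<in> E" shows "d x y = \<omega> {x, y}"
proof (rule antisym)
  show "d x y \<le> \<omega> {x, y}"
    using dist_step[OF e] dist_self[of y] adjacentD[OF e] by fastforce
  let ?f = "\<lambda>u. if u \<in> side x y then \<omega> {x, y} else 0"
  have "?f x - ?f y \<le> d x y"
  proof (rule diff_le_dist)
    show "?f a - ?f b \<le> \<omega> {a, b}" if "adjacent E a b" for a b
      using that side_step[of a x y b] \<omega>_pos[of "{a, b}"] \<omega>_pos[OF e]
      by (cases "{a, b} = {x, y}") (simp_all add: adjacent_def)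
  qed (use adjacentD[OF e] in auto)
  then show "\<omega> {x, y} \<le> d x y" using side_self not_in_side[OF e] by auto
qed

text \<open>The Kantorovich potential that turns out to be optimal. Measuring each side from its own
  endpoint gives the values at the neighbours directly from edge weights.\<close>

definition potential :: "'a \<Rightarrow> 'a \<Rightarrow> 'a \<Rightarrow> real" where
  "potential x y u = (if u \<in> side x y then \<omega> {x, y} + d u x else - d u y)"

text \<open>Only \<open>{x, y}\<close> joins the two sides, and there the jump is exactly its
  weight. Any other edge stays within one branch, where the triangle inequality suffices.\<close>

lemma potential_lipschitz:
  assumes e: "{x, y} \<in> E" and ab: "adjacent E a b"
  shows "potential x y a - potential x y b \<le> \<omega> {a, b}"
proof -
  note V = adjacentD[OF e]
  have E: "{a, b} \<in> E" "{b, a} \<in> E" using ab by (simp_all add: adjacent_def insert_commute)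
  show ?thesis
  proof (cases "{a, b} = {x, y}")
    case True
    then consider "a = x" "b = y" | "a = y" "b = x" by (auto simp: doubleton_eq_iff)
    then show ?thesis
      using side_self[of x y] not_in_side[OF e] V dist_self \<omega>_pos[OF e]
      by cases (auto simp: potential_def insert_commute)
  next
    case False
    then have "a \<in> side x y \<longleftrightarrow> b \<in> side x y"
      using side_step[of a x y b] side_step[of b x y a] E by (auto simp: insert_commute)
    then show ?thesis
      using dist_step[OF E(1), of x] dist_step[OF E(2), of y] V
      by (auto simp: potential_def insert_commute)
  qed
qed

lemma lap_remove:
  assumes "{x, y} \<in> E"
  shows "lap x g = 1 / m1 x * (m2 {x, y} * (g y - g x) + (\<Sum>z\<in>N x - {y}. m2 {x, z} * (g z - g x)))"
proof -
  have "y \<in> N x" using assms by (simp add: adjacent_def)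
  then show ?thesis unfolding lap_def by (simp only: sum.remove[OF finite_N])
qed

text \<open>Primal and dual bounds meet: \<open>potential\<close> gives the lower bound and
  \<open>edge_coupling\<close> the upper one. The formula is exact for small
  \<open>\<epsilon>\<close>, not merely asymptotic.\<close>

lemma wasserstein_eq:
  assumes e: "{x, y} \<in> E" and "\<epsilon> \<ge> 0"
    and small: "\<epsilon> * (weighted_degree E m1 m2 x + weighted_degree E m1 m2 y) \<le> 1"
  shows "wasserstein V d (step_measure E m1 m2 \<epsilon> x) (step_measure E m1 m2 \<epsilon> y)
    = \<omega> {x, y} + \<epsilon> * (\<Sum>f\<in>E. generator {x, y} f * \<omega> f)"
proof -
  note V = adjacentD[OF e]
  let ?\<mu> = "step_measure E m1 m2 \<epsilon>"
  let ?G = "\<Sum>f\<in>E. generator {x, y} f * \<omega> f"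
  let ?W = "{\<Sum>u\<in>V. \<Sum>v\<in>V. d u v * A u v | A. coupling V (?\<mu> x) (?\<mu> y) A}"
  let ?f = "potential x y"
  have e': "{y, x} \<in> E" using e by (simp add: insert_commute)
  have fx: "?f x = \<omega> {x, y}" and fy: "?f y = 0"
    using side_self not_in_side[OF e] V dist_self by (auto simp: potential_def)
  have fz: "?f z - ?f x = \<omega> {x, z}" if "z \<in> N x - {y}" for z
  proof -
    have "{x, z} \<in> E" "{x, z} \<noteq> {x, y}" using that by (auto simp: adjacent_def doubleton_eq_iff)
    then show ?thesis using side_step[OF side_self] dist_adjacent[of z x] fx
      by (simp add: potential_def insert_commute)
  qed
  have fw: "?f z - ?f y = - \<omega> {y, z}" if "z \<in> N y - {x}" for z
  proof -
    have z: "{y, z} \<in> E" "{z, y} \<in> E" "{z, y} \<noteq> {x, y}"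
      using that by (auto simp: adjacent_def doubleton_eq_iff insert_commute)
    then have "z \<notin> side x y" using side_step[of z x y y] not_in_side[OF e] by blast
    then show ?thesis using dist_adjacent[OF z(2)] fy by (simp add: potential_def insert_commute)
  qed
  have G: "lap x ?f - lap y ?f = ?G"
  proof -
    have "(\<Sum>z\<in>N x - {y}. m2 {x, z} * (?f z - \<omega> {x, y})) = (\<Sum>z\<in>N x - {y}. m2 {x, z} * \<omega> {x, z})"
      using fz by (intro sum.cong refl) (simp only: fx)
    moreover have "(\<Sum>z\<in>N y - {x}. m2 {y, z} * (?f z - 0)) = - (\<Sum>z\<in>N y - {x}. m2 {y, z} * \<omega> {y, z})"
      unfolding sum_negf[symmetric] using fw by (intro sum.cong refl) (simp only: fy mult_minus_right)
    ultimately show ?thesis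
      unfolding lap_remove[OF e] lap_remove[OF e'] sum_generator[OF e] fx fy
      by (simp only: insert_commute[of y x]) (simp add: algebra_simps)
  qed
  have lower: "\<omega> {x, y} + \<epsilon> * ?G \<le> c" if "c \<in> ?W" for c
  proof -
    have lip: "?f u - ?f v \<le> d u v" if "u \<in> V" "v \<in> V" for u v
      by (rule diff_le_dist[OF that potential_lipschitz[OF e]])
    then show ?thesis
      using that wasserstein_ge[OF V(1,2), of ?f d \<epsilon>, OF lip] fx fy unfolding G[symmetric]
      by (auto simp: algebra_simps)
  qed
  let ?A = "edge_coupling \<epsilon> x y"
  have in_W: "(\<Sum>u\<in>V. \<Sum>v\<in>V. d u v * ?A u v) \<in> ?W"
    using coupling_edge_coupling[OF assms] by blast
  \<comment> \<open>The triangle inequality is enough here, since the matching lower bound is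
    already known.\<close>
  have "lap x (\<lambda>u. d u y) + lap y (d x) \<le> ?G"
  proof -
    have "m2 {x, z} * (d z y - d x y) \<le> m2 {x, z} * \<omega> {x, z}" if "z \<in> N x - {y}" for z
      using that m2_pos[of "{x, z}"] dist_step[of z x y] V
      by (intro mult_left_mono) (auto simp: adjacent_def insert_commute)
    moreover have "m2 {y, z} * (d x z - d x y) \<le> m2 {y, z} * \<omega> {y, z}" if "z \<in> N y - {x}" for z
      using that m2_pos[of "{y, z}"] dist_step[OF e, of z] dist_adjacent[of y z] dist_adjacent[OF e] adjacentD[of y z]
      by (intro mult_left_mono) (auto simp: adjacent_def)
    ultimately show ?thesis
      unfolding lap_remove[OF e] lap_remove[OF e'] sum_generator[OF e]
      using m1_pos V dist_self dist_adjacent[OF e]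
      by (intro add_mono mult_left_mono) (auto simp: insert_commute[of y x] intro: sum_mono less_imp_le)
  qed
  then have "(\<Sum>u\<in>V. \<Sum>v\<in>V. d u v * ?A u v) \<le> \<omega> {x, y} + \<epsilon> * ?G"
    using \<open>\<epsilon> \<ge> 0\<close> by (simp add: cost_edge_coupling[OF V(1,2)] dist_adjacent[OF e] mult_left_mono)
  then have "Inf ?W \<le> \<omega> {x, y} + \<epsilon> * ?G"
    using lower in_W by (meson bdd_belowI cInf_lower2)
  moreover have "\<omega> {x, y} + \<epsilon> * ?G \<le> Inf ?W"
    using lower in_W by (intro cInf_greatest) auto
  ultimately show ?thesis by (simp add: wasserstein_def)
qed

text \<open>By the exact cost formula the difference quotient is constant for all small positive
  \<open>\<epsilon>\<close>, so the limit is that constant.\<close>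

lemma lly_curvature_eq:
  assumes e: "{x, y} \<in> E"
  shows "lly_curvature V E m1 m2 \<omega> x y = - (\<Sum>f\<in>E. generator {x, y} f * \<omega> f) / \<omega> {x, y}"
  unfolding lly_curvature_def
proof (rule tendsto_Lim, simp, rule tendsto_eventually)
  let ?D = "weighted_degree E m1 m2 x + weighted_degree E m1 m2 y"
  have "((\<lambda>\<epsilon>. \<epsilon> * ?D) \<longlongrightarrow> 0) (at_right 0)"
    by (auto intro!: tendsto_eq_intros)
  then have "\<forall>\<^sub>F \<epsilon> in at_right 0. \<epsilon> * ?D < 1"
    by (rule order_tendstoD) simp
  then show "\<forall>\<^sub>F \<epsilon> in at_right 0. 1 / \<epsilon> * (1 - wasserstein V d (step_measure E m1 m2 \<epsilon> x)
      (step_measure E m1 m2 \<epsilon> y) / d x y) = - (\<Sum>f\<in>E. generator {x, y} f * \<omega> f) / \<omega> {x, y}"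
    using eventually_at_right_less[of 0]
  proof eventually_elim
    case (elim \<epsilon>)
    then show ?case using \<omega>_pos[OF e]
      by (simp add: wasserstein_eq[OF e] dist_adjacent[OF e]) (simp add: field_simps)
  qed
qed

end

section \<open>Convergence of the curvature flow\<close>

theorem theorem1p2:
  fixes V :: "'a set" and E :: "'a set set"
    and m1 :: "'a \<Rightarrow> real" and m2 :: "'a set \<Rightarrow> real"
    and \<omega>0 :: "'a set \<Rightarrow> real" and \<omega> :: "real \<Rightarrow> 'a set \<Rightarrow> real"
  assumes "finite_tree V E" and "E \<noteq> {}"
    and "\<forall>x\<in>V. m1 x > 0" and "\<forall>e\<in>E. m2 e > 0"
    and "\<forall>e\<in>E. \<omega>0 e > 0"
    and "lly_flow_solution V E m1 m2 \<omega>0 \<omega>"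
  shows "(\<exists>c::real. \<forall>x y. {x, y} \<in> E \<longrightarrow>
            ((\<lambda>t. lly_curvature V E m1 m2 (\<omega> t) x y) \<longlongrightarrow> c) at_top) \<and>
         (\<exists>\<omega>inf :: 'a set \<Rightarrow> real.
            (\<forall>e\<in>E. \<omega>inf e > 0) \<and>
            (\<forall>e\<in>E. ((\<lambda>t. normalized_weight E (\<omega> t) e) \<longlongrightarrow> \<omega>inf e) at_top) \<and>
            constant_curvature V E m1 m2 \<omega>inf)"
proof -
  interpret measured_tree V E m1 m2
    using assms(1,3,4) by unfold_locales auto
  have pos: "\<omega> t e > 0" if "t \<ge> 0" "e \<in> E" for t e
    using assms(6) that by (simp add: lly_flow_solution_def)
  \<comment> \<open>Stated for an arbitrary positive weight, because it is applied along the flow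
    and also to the limit metric.\<close>
  have curv: "lly_curvature V E m1 m2 w x y = - (\<Sum>f\<in>E. generator {x, y} f * w f) / w {x, y}"
    if "\<And>e. e \<in> E \<Longrightarrow> w e > 0" "{x, y} \<in> E" for w x y
  proof -
    interpret weighted_tree V E m1 m2 w by unfold_locales (rule that)
    show ?thesis by (rule lly_curvature_eq[OF that(2)])
  qed
  have flow: "((\<lambda>s. \<omega> s e) has_real_derivative (\<Sum>f\<in>E. generator e f * \<omega> t f)) (at t)"
    if t: "t > 0" and e: "e \<in> E" for t e
  proof -
    obtain x y where xy: "e = {x, y}" using edgeD[OF e] by blast
    have "((\<lambda>s. \<omega> s {x, y}) has_real_derivative
        - lly_curvature V E m1 m2 (\<omega> t) x y * \<omega> t {x, y}) (at t)"
      using assms(6) t e unfolding xy lly_flow_solution_def by blast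
    then show ?thesis
      using curv[of "\<omega> t" x y] pos[of t] t e by (auto simp: xy less_imp_neq[symmetric])
  qed
  from symmetrizable_flow_asymptotics[of E m2 generator \<omega>, OF finite_E assms(2) m2_pos
      generator_symmetrizable generator_nonneg edges_connected pos[OF less_imp_le] flow]
  obtain l v where v: "\<And>e. e \<in> E \<Longrightarrow> v e > 0"
    and eig: "\<And>e. e \<in> E \<Longrightarrow> (\<Sum>f\<in>E. generator e f * v f) = l * v e"
    and lim: "\<And>e. e \<in> E \<Longrightarrow> ((\<lambda>t. exp (- l * t) * \<omega> t e) \<longlongrightarrow> v e) at_top"
    by blast
  \<comment> \<open>The curvature is invariant under scaling of the weight, so
    \<open>\<omega> t\<close> may be replaced by its convergent rescaling. At the limit
    \<open>v\<close> the eigenvalue equation gives \<open>- l\<close>.\<close>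
  have "((\<lambda>t. lly_curvature V E m1 m2 (\<omega> t) x y) \<longlongrightarrow> - l) at_top" if e: "{x, y} \<in> E" for x y
  proof -
    have "((\<lambda>t. - (\<Sum>f\<in>E. generator {x, y} f * (exp (- l * t) * \<omega> t f)) / (exp (- l * t) * \<omega> t {x, y}))
        \<longlongrightarrow> - (\<Sum>f\<in>E. generator {x, y} f * v f) / v {x, y}) at_top"
      using v[OF e] by (intro tendsto_intros lim e) auto
    moreover have "- (\<Sum>f\<in>E. generator {x, y} f * v f) / v {x, y} = - l"
      using v[OF e] by (simp add: eig[OF e])
    moreover have "\<forall>\<^sub>F t in at_top. - (\<Sum>f\<in>E. generator {x, y} f * (exp (- l * t) * \<omega> t f)) / (exp (- l * t) * \<omega> t {x, y})
        = lly_curvature V E m1 m2 (\<omega> t) x y"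
      using eventually_ge_at_top[of 0]
    proof eventually_elim
      case (elim t)
      have "(\<Sum>f\<in>E. generator {x, y} f * (exp (- l * t) * \<omega> t f)) = exp (- l * t) * (\<Sum>f\<in>E. generator {x, y} f * \<omega> t f)"
        by (simp add: sum_distrib_left mult.left_commute)
      then show ?case using curv[OF pos[OF elim] e] by simp
    qed
    ultimately show ?thesis by (auto dest: tendsto_cong[THEN iffD1])
  qed
  moreover define V' where "V' = sum v E"
  have V': "V' > 0" using v finite_E assms(2) by (auto simp: V'_def intro: sum_pos)
  \<comment> \<open>The exponential factor cancels between numerator and denominator.\<close>
  have "((\<lambda>t. normalized_weight E (\<omega> t) e) \<longlongrightarrow> v e / V') at_top" if e: "e \<in> E" for e
  proof -
    have "((\<lambda>t. (exp (- l * t) * \<omega> t e) / (\<Sum>h\<in>E. exp (- l * t) * \<omega> t h)) \<longlongrightarrow> v e / V') at_top"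
      using V' unfolding V'_def by (intro tendsto_intros lim e) auto
    then show ?thesis by (simp add: normalized_weight_def sum_distrib_left[symmetric])
  qed
  moreover have "constant_curvature V E m1 m2 (\<lambda>e. v e / V')"
    unfolding constant_curvature_def
  proof (intro exI[of _ "- l"] allI impI)
    fix x y assume e: "{x, y} \<in> E"
    show "lly_curvature V E m1 m2 (\<lambda>e. v e / V') x y = - l"
      using curv[of "\<lambda>e. v e / V'", OF _ e] v V' e
      by (simp add: sum_divide_distrib[symmetric] eig less_imp_neq[symmetric])
  qed
  ultimately show ?thesis using v V' by (intro conjI exI[of _ "- l"] exI[of _ "\<lambda>e. v e / V'"]) auto
qed

end
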